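(* If $n$ and $t$ are integers, then $$\sum_{j=1}^nG_{j+t}^3G_{j+t+1}^3=\frac14\left(G_{n+t}^2G_{n+t+1}^2G_{n+t+2}^2-G_t^2G_{t+1}^2G_{t+2}^2\right),$$ $$\sum_{j=1}^n\frac{1}{G_{j+t-1}^2G_{j+t}G_{j+t+1}G_{j+t+2}^2}=\frac14\left(\frac{1}{G_t^2G_{t+1}^2G_{t+2}^2}-\frac{1}{G_{n+t}^2G_{n+t+1}^2G_{n+t+2}^2}\right).$$
   Context: Here $(G_j)_{j\in\mathbb Z}$ is the generalized Fibonacci sequence, having the same recurrence relation as the Fibonacci and Lucas sequences but starting with arbitrary initial values: $G_j=G_{j-1}+G_{j-2}$ for $j\ge 2$, where $G_0$ and $G_1$ are arbitrary numbers (usually integers), not both zero, with $G_{-j}=G_{-(j-2)}-G_{-(j-1)}$ giving the terms of negative index. *)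

theory Defs
  imports Complex_Main
begin

definition generalized_fibonacci :: "(int \<Rightarrow> complex) \<Rightarrow> bool" where
  "generalized_fibonacci G \<longleftrightarrow>
     (G 0 \<noteq> 0 \<or> G 1 \<noteq> 0) \<and>
     (\<forall>j\<ge>2. G j = G (j - 1) + G (j - 2)) \<and>
     (\<forall>j\<ge>1. G (- j) = G (- (j - 2)) - G (- (j - 1)))"

text \<open>
  The sum of \<open>f j\<close> for \<open>j\<close> from \<open>1\<close> to \<open>n\<close>, for an arbitrary integer upper limit. For negative
  \<open>n\<close> it follows the usual convention for reversed limits of summation, the one for which
  \<open>sum_from_1 f n - sum_from_1 f (n - 1) = f n\<close> holds for every integer \<open>n\<close>. (The library's
  \<open>sum f {1..n}\<close> is \<open>0\<close> for all \<open>n \<le> 0\<close>.)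
\<close>

definition sum_from_1 :: "(int \<Rightarrow> complex) \<Rightarrow> int \<Rightarrow> complex" where
  "sum_from_1 f n = (if n \<ge> 0 then \<Sum>j=1..n. f j else - (\<Sum>j=n+1..0. f j))"

end

theory Submission imports Defs begin

text \<open>
  Both sums telescope. Let \<open>P m\<close> be the product of the squares of \<open>G m\<close>, \<open>G (m + 1)\<close> and
  \<open>G (m + 2)\<close>. For four consecutive terms \<open>a, b, c, d\<close> one has \<open>c = a + b\<close>, hence \<open>d - a = 2 b\<close>
  and \<open>d + a = 2 c\<close>, so that \<open>d\<^sup>2 - a\<^sup>2 = 4 b c\<close>. With \<open>a = G (m - 1)\<close>, multiplying this
  by \<open>b\<^sup>2 c\<^sup>2\<close> gives \<open>P m - P (m - 1) = 4 b\<^sup>3 c\<^sup>3\<close>, and dividing it by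
  \<open>a\<^sup>2 b\<^sup>2 c\<^sup>2 d\<^sup>2\<close> gives \<open>1 / P (m - 1) - 1 / P m = 4 / (a\<^sup>2 b c d\<^sup>2)\<close>. These are four
  times the summands (\<open>generalized_fibonacci_cubes\<close> and \<open>generalized_fibonacci_reciprocals\<close>), and
  \<open>sum_from_1_telescope\<close> adds them up for either sign of the upper limit.
\<close>

lemma sum_int_telescope:
  fixes F f :: "int \<Rightarrow> 'a::ab_group_add"
  assumes "m \<le> n" and "\<And>j. j \<in> {m+1..n} \<Longrightarrow> f j = F j - F (j - 1)"
  shows "(\<Sum>j=m+1..n. f j) = F n - F m"
  using assms
proof (induction n rule: int_ge_induct)
  case base
  show ?case by simp
next
  case (step n)
  have "{m+1..n+1} = insert (n+1) {m+1..n}"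
    using step.hyps by auto
  then show ?case
    using step by simp
qed

text \<open>
  The convention for reversed limits is the one under which telescoping needs no restriction on the
  sign of \<open>n\<close>. The hypothesis is confined to the indices that actually occur, because the
  reciprocal summands telescope only where the terms of the sequence do not vanish.
\<close>

lemma sum_from_1_telescope:
  assumes "\<And>j. min 0 n + 1 \<le> j \<Longrightarrow> j \<le> max 0 n \<Longrightarrow> f j = F j - F (j - 1)"
  shows "sum_from_1 f n = F n - F 0"
proof (cases "n \<ge> 0")
  case True
  then have "(\<Sum>j=0+1..n. f j) = F n - F 0"
    using assms by (intro sum_int_telescope) auto
  with True show ?thesis by (simp add: sum_from_1_def)
next
  case False
  then have "(\<Sum>j=n+1..0. f j) = F 0 - F n"
    using assms by (intro sum_int_telescope) auto
  with False show ?thesis by (simp add: sum_from_1_def)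
qed

text \<open>
  The two one-sided recurrences of the definition, upward from \<open>G 0, G 1\<close> and downward from them,
  are the same relation, and together they cover every index.
\<close>

lemma generalized_fibonacci_rec:
  assumes "generalized_fibonacci G"
  shows "G (m + 2) = G (m + 1) + G m"
proof (cases "m \<ge> 0")
  case True
  then have "G (m + 2) = G (m + 2 - 1) + G (m + 2 - 2)"
    using assms unfolding generalized_fibonacci_def by (metis le_add_same_cancel2)
  then show ?thesis by (simp add: algebra_simps)
next
  case False
  then have "G (- (- m)) = G (- (- m - 2)) - G (- (- m - 1))"
    using assms unfolding generalized_fibonacci_def by (metis int_one_le_iff_zero_less neg_0_less_iff_less not_le)
  then show ?thesis by (simp add: algebra_simps)
qed

lemma generalized_fibonacci_square_diff:
  assumes "generalized_fibonacci G"
  shows "G (m + 2) ^ 2 - G (m - 1) ^ 2 = 4 * G m * G (m + 1)"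
proof -
  have "G (m + 1) = G m + G (m - 1)" and "G (m + 2) = G (m + 1) + G m"
    using generalized_fibonacci_rec[OF assms, of "m - 1"] generalized_fibonacci_rec[OF assms, of m]
    by (simp_all add: add.commute)
  then show ?thesis by (simp add: power2_eq_square algebra_simps)
qed

lemma generalized_fibonacci_cubes:
  assumes "generalized_fibonacci G"
  shows "G m ^ 3 * G (m + 1) ^ 3 =
           1 / 4 * (G m ^ 2 * G (m + 1) ^ 2 * G (m + 2) ^ 2
                    - G (m - 1) ^ 2 * G m ^ 2 * G (m + 1) ^ 2)"
proof -
  have "G m ^ 2 * G (m + 1) ^ 2 * G (m + 2) ^ 2 - G (m - 1) ^ 2 * G m ^ 2 * G (m + 1) ^ 2
        = G m ^ 2 * G (m + 1) ^ 2 * (G (m + 2) ^ 2 - G (m - 1) ^ 2)"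
    by (simp add: algebra_simps)
  also have "\<dots> = 4 * (G m ^ 3 * G (m + 1) ^ 3)"
    unfolding generalized_fibonacci_square_diff[OF assms]
    by (simp add: power2_eq_square power3_eq_cube)
  finally show ?thesis by simp
qed

lemma generalized_fibonacci_reciprocals:
  assumes "generalized_fibonacci G"
    and nz: "G (m - 1) \<noteq> 0" "G m \<noteq> 0" "G (m + 1) \<noteq> 0" "G (m + 2) \<noteq> 0"
  shows "1 / (G (m - 1) ^ 2 * G m * G (m + 1) * G (m + 2) ^ 2) =
           1 / 4 * (1 / (G (m - 1) ^ 2 * G m ^ 2 * G (m + 1) ^ 2)
                    - 1 / (G m ^ 2 * G (m + 1) ^ 2 * G (m + 2) ^ 2))"
proof -
  have "1 / (G (m - 1) ^ 2 * G m ^ 2 * G (m + 1) ^ 2) - 1 / (G m ^ 2 * G (m + 1) ^ 2 * G (m + 2) ^ 2)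
        = (G (m + 2) ^ 2 - G (m - 1) ^ 2)
            / (G (m - 1) ^ 2 * G m ^ 2 * G (m + 1) ^ 2 * G (m + 2) ^ 2)"
    using nz by (simp add: divide_simps)
  also have "\<dots> = 4 * (1 / (G (m - 1) ^ 2 * G m * G (m + 1) * G (m + 2) ^ 2))"
    unfolding generalized_fibonacci_square_diff[OF assms(1)]
    using nz by (simp add: divide_simps power2_eq_square)
  finally show ?thesis by simp
qed

theorem proposition6:
  fixes G :: "int \<Rightarrow> complex" and n t :: int
  assumes "generalized_fibonacci G"
  shows "sum_from_1 (\<lambda>j. G (j + t) ^ 3 * G (j + t + 1) ^ 3) n =
           1 / 4 * (G (n + t) ^ 2 * G (n + t + 1) ^ 2 * G (n + t + 2) ^ 2
                    - G t ^ 2 * G (t + 1) ^ 2 * G (t + 2) ^ 2)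
         \<and>
         ((\<forall>k\<in>{min t (n + t)..max t (n + t) + 2}. G k \<noteq> 0) \<longrightarrow>
           sum_from_1 (\<lambda>j. 1 / (G (j + t - 1) ^ 2 * G (j + t) * G (j + t + 1) * G (j + t + 2) ^ 2)) n =
           1 / 4 * (1 / (G t ^ 2 * G (t + 1) ^ 2 * G (t + 2) ^ 2)
                    - 1 / (G (n + t) ^ 2 * G (n + t + 1) ^ 2 * G (n + t + 2) ^ 2)))"
proof (intro conjI impI)
  let ?P = "\<lambda>m. G m ^ 2 * G (m + 1) ^ 2 * G (m + 2) ^ 2"
  let ?c = "\<lambda>j. G (j + t) ^ 3 * G (j + t + 1) ^ 3"
  let ?C = "\<lambda>j. 1 / 4 * ?P (j + t)"
  have "sum_from_1 ?c n = ?C n - ?C 0"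
  proof (rule sum_from_1_telescope)
    fix j
    have "?c j = 1 / 4 * (?P (j + t) - ?P (j + t - 1))"
      using generalized_fibonacci_cubes[OF assms, of "j + t"] by (simp add: add.commute)
    also have "\<dots> = ?C j - ?C (j - 1)" by (simp add: algebra_simps)
    finally show "?c j = ?C j - ?C (j - 1)" .
  qed
  then show "sum_from_1 ?c n = 1 / 4 * (?P (n + t) - ?P t)"
    by (simp add: algebra_simps)
  assume nz: "\<forall>k\<in>{min t (n + t)..max t (n + t) + 2}. G k \<noteq> 0"
  let ?f = "\<lambda>j. 1 / (G (j + t - 1) ^ 2 * G (j + t) * G (j + t + 1) * G (j + t + 2) ^ 2)"
  \<comment> \<open>The signs in the reciprocal telescoping are reversed, hence the minus in the antidifference.\<close>
  let ?F = "\<lambda>j. - (1 / 4 * (1 / ?P (j + t)))"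
  have "sum_from_1 ?f n = ?F n - ?F 0"
  proof (rule sum_from_1_telescope)
    fix j assume "min 0 n + 1 \<le> j" "j \<le> max 0 n"
    then have "{j + t - 1..j + t + 2} \<subseteq> {min t (n + t)..max t (n + t) + 2}"
      by (auto simp: min_def max_def split: if_splits)
    with nz have "\<forall>k\<in>{j + t - 1..j + t + 2}. G k \<noteq> 0" by blast
    then have "G (j + t - 1) \<noteq> 0" "G (j + t) \<noteq> 0" "G (j + t + 1) \<noteq> 0" "G (j + t + 2) \<noteq> 0"
      by simp_all
    from generalized_fibonacci_reciprocals[OF assms this]
    have "?f j = 1 / 4 * (1 / ?P (j + t - 1) - 1 / ?P (j + t))" by (simp add: add.commute)
    also have "\<dots> = ?F j - ?F (j - 1)" by (simp add: algebra_simps)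
    finally show "?f j = ?F j - ?F (j - 1)" .
  qed
  then show "sum_from_1 ?f n = 1 / 4 * (1 / ?P t - 1 / ?P (n + t))"
    by (simp add: algebra_simps)
qed

end
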